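(* Let $X=(X_1,\dots,X_p)$ be a random vector in $\mathbb{R}^p$ with strictly positive, $p+1$ times continuously differentiable density $f_X$. Let $I,J,K$ be three index sets which partition $\{1,\dots,p\}$, and let $S=\{e_i+e_j: i\in I,\ j\in J\}$. Then $X_I$ and $X_J$ are conditionally independent given $X_K$ if and only if $\kappa_k^x=0$ for all $k\in S$ and all $x\in\mathbb{R}^p$.
   Context: $e_i$ is the $i$-th standard unit vector of $\mathbb{R}^p$; for $L\subseteq\{1,\dots,p\}$, $X_L=(X_l)_{l\in L}$. For $k=e_i+e_j$ with $i\ne j$, the differential cumulant at $x$ is $\kappa_k^x=\frac{\partial^2}{\partial x_i\partial x_j}\log f_X(x)$. *)

theory Defs
  imports "HOL-Probability.Probability"
begin

definition partial_deriv :: "'n::finite \<Rightarrow> (real^'n \<Rightarrow> real) \<Rightarrow> real^'n \<Rightarrow> real" where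
  "partial_deriv i g x = deriv (\<lambda>t. g (x + t *\<^sub>R axis i 1)) 0"

text \<open>
  Continuously differentiable \<open>k\<close> times on the whole space. Total (Frechet) differentiability
  is required at each stage, so every partial derivative of order at most \<open>k\<close> exists, and all
  of them are continuous.
\<close>

primrec C_k :: "nat \<Rightarrow> (real^'n::finite \<Rightarrow> real) \<Rightarrow> bool" where
  "C_k 0 g \<longleftrightarrow> continuous_on UNIV g"
| "C_k (Suc k) g \<longleftrightarrow> g differentiable_on UNIV \<and> (\<forall>i. C_k k (partial_deriv i g))"

text \<open>
  The differential cumulant \<open>\<kappa>\<^sub>k\<^sup>x\<close> of a density \<open>f\<close> for the multi-index
  \<open>k = e\<^sub>i + e\<^sub>j\<close> with \<open>i \<noteq> j\<close>; such a multi-index is given by the pair \<open>i\<close>, \<open>j\<close>.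
\<close>

definition diff_cumulant ::
    "(real^'n::finite \<Rightarrow> real) \<Rightarrow> 'n \<Rightarrow> 'n \<Rightarrow> real^'n \<Rightarrow> real" where
  "diff_cumulant f i j x = partial_deriv i (partial_deriv j (\<lambda>y. ln (f y))) x"

definition subvector :: "'n set \<Rightarrow> real^'n::finite \<Rightarrow> 'n \<Rightarrow> real" where
  "subvector L x = (\<lambda>l\<in>L. x $ l)"

definition cond_prob_given ::
    "'a measure \<Rightarrow> 'd measure \<Rightarrow> ('a \<Rightarrow> 'd) \<Rightarrow> 'a set \<Rightarrow> 'a \<Rightarrow> real" where
  "cond_prob_given M N W E =
     real_cond_exp M (vimage_algebra (space M) W N) (indicator E)"

text \<open>
  \<open>U\<close> and \<open>V\<close> are conditionally independent given \<open>W\<close>: almost surely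
  \<open>P (U \<in> A, V \<in> B | W) = P (U \<in> A | W) * P (V \<in> B | W)\<close> for all measurable \<open>A\<close>, \<open>B\<close>.
\<close>

definition cond_indep_var ::
    "'a measure \<Rightarrow> 'b measure \<Rightarrow> ('a \<Rightarrow> 'b) \<Rightarrow> 'c measure \<Rightarrow> ('a \<Rightarrow> 'c)
      \<Rightarrow> 'd measure \<Rightarrow> ('a \<Rightarrow> 'd) \<Rightarrow> bool" where
  "cond_indep_var M MU U MV V MW W \<longleftrightarrow>
     U \<in> measurable M MU \<and> V \<in> measurable M MV \<and> W \<in> measurable M MW \<and>
     (\<forall>A\<in>sets MU. \<forall>B\<in>sets MV. AE \<omega> in M.
        cond_prob_given M MW W ((U -` A \<inter> space M) \<inter> (V -` B \<inter> space M)) \<omega> =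
        cond_prob_given M MW W (U -` A \<inter> space M) \<omega> *
        cond_prob_given M MW W (V -` B \<inter> space M) \<omega>)"

definition cond_indep_subvectors ::
    "'a measure \<Rightarrow> ('a \<Rightarrow> real^'n::finite) \<Rightarrow> 'n set \<Rightarrow> 'n set \<Rightarrow> 'n set \<Rightarrow> bool" where
  "cond_indep_subvectors M X I J K \<longleftrightarrow>
     cond_indep_var M
       (Pi\<^sub>M I (\<lambda>_. borel)) (\<lambda>\<omega>. subvector I (X \<omega>))
       (Pi\<^sub>M J (\<lambda>_. borel)) (\<lambda>\<omega>. subvector J (X \<omega>))
       (Pi\<^sub>M K (\<lambda>_. borel)) (\<lambda>\<omega>. subvector K (X \<omega>))"

end

(* Relative to the standard Gaussian gamma on R^p the law of X has the density g = f / phi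
   (rel_density), and P(X in E | X_K) is the gamma-average of 1_E g over the coordinates outside
   K, divided by the gamma-average of g. Exchanging the J-coordinates of two points preserves
   gamma x gamma, so for cylinder sets A, A' in the I-coordinates and B, B' in the J-coordinates
   N(A,B) N(A',B') - N(A,B') N(A',B) is the integral over (A x B) x (A' x B') of
   g(y) g(z) - g(y') g(z'), where N(A,B) is that numerator for E = A x B, and (y', z') is the pair
   after the exchange. Taking A' and B' to be everything shows that conditional independence holds
   if g(y) g(z) = g(y') g(z') whenever y and z agree on K; taking small boxes shows, by continuity,
   that it is also necessary. The factor phi satisfies this exchange identity, so it may be
   stated for f, and for log f it says that the mixed partial derivatives vanish. *)

theory Submission
  imports Defs
begin

section \<open>Exchanging coordinates of Gaussian vectors\<close>

definition mix :: "'n set \<Rightarrow> real^'n::finite \<Rightarrow> real^'n \<Rightarrow> real^'n" where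
  "mix L x y = (\<chi> i. if i \<in> L then x $ i else y $ i)"

definition coord_swap :: "'n set \<Rightarrow> (real^'n::finite) \<times> (real^'n) \<Rightarrow> (real^'n) \<times> (real^'n)" where
  "coord_swap L p = (mix L (snd p) (fst p), mix L (fst p) (snd p))"

definition gauss_density :: "real^'n::finite \<Rightarrow> real" where
  "gauss_density x = (\<Prod>i\<in>UNIV. std_normal_density (x $ i))"

definition gauss :: "(real^'n::finite) measure" where
  "gauss = density lborel (\<lambda>x. ennreal (gauss_density x))"

section \<open>Coordinate exchanges as permutations\<close>

lemma mix_nth [simp]: "mix L x y $ i = (if i \<in> L then x $ i else y $ i)"
  by (simp add: mix_def)

lemma mix_self [simp]: "mix L x x = x"
  by (simp add: vec_eq_iff)

lemma mix_mix_left [simp]: "mix L (mix L x y) z = mix L x z"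
  by (simp add: vec_eq_iff)

lemma mix_mix_right [simp]: "mix L x (mix L y z) = mix L x z"
  by (simp add: vec_eq_iff)

lemma coord_swap_Pair [simp]: "coord_swap L (x, y) = (mix L y x, mix L x y)"
  by (simp add: coord_swap_def)

lemma continuous_on_mix [continuous_intros]:
  assumes "continuous_on S f" "continuous_on S g"
  shows "continuous_on S (\<lambda>p. mix L (f p) (g p))"
  unfolding mix_def
  by (intro continuous_on_vec_lambda, case_tac "i \<in> L") (auto intro!: continuous_intros assms)

lemma measurable_mix [measurable]:
  assumes [measurable]: "f \<in> borel_measurable N" "g \<in> borel_measurable N"
  shows "(\<lambda>p. mix L (f p) (g p)) \<in> borel_measurable N"
proof -
  have "(\<lambda>p. mix L (fst p) (snd p)) \<in> borel_measurable borel"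
    by (intro borel_measurable_continuous_onI continuous_intros)
  then have "(\<lambda>p. mix L (fst p) (snd p)) \<in> borel_measurable (borel \<Otimes>\<^sub>M borel)"
    by (simp add: borel_prod)
  from measurable_compose[OF _ this, of "\<lambda>p. (f p, g p)"] show ?thesis
    by simp
qed

lemma measurable_coord_swap [measurable]: "coord_swap L \<in> measurable (borel \<Otimes>\<^sub>M borel) (borel \<Otimes>\<^sub>M borel)"
  unfolding coord_swap_def by measurable

lemma coord_swap_involution [simp]: "coord_swap L (coord_swap L p) = p"
  by (cases p) (simp add: vec_eq_iff)

text \<open>An involutive permutation of the coordinates of a pair is its own adjoint.\<close>

lemma coord_swap_inner: "coord_swap L p \<bullet> q = p \<bullet> coord_swap L q"
  by (cases p; cases q)
     (auto simp: inner_vec_def simp flip: sum.distrib intro!: sum.cong)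

lemma coord_swap_diff: "coord_swap L (p - q) = coord_swap L p - coord_swap L q"
  by (cases p; cases q) (simp add: vec_eq_iff)

lemma mix_axis:
  "mix L (axis i c) 0 = (if i \<in> L then axis i c else 0)"
  "mix L 0 (axis i c) = (if i \<in> L then 0 else axis i c)"
  by (auto simp: vec_eq_iff axis_def)

lemma coord_swap_Basis:
  assumes "b \<in> Basis"
  shows "coord_swap L b \<in> Basis"
proof -
  have "coord_swap L (axis i 1, 0) \<in> Basis" "coord_swap L (0, axis i 1) \<in> Basis" for i
    by (cases "i \<in> L"; simp add: mix_axis Basis_prod_def image_iff axis_in_Basis_iff)+
  moreover obtain i where "b = (axis i 1, 0) \<or> b = (0, axis i 1)"
    using assms by (auto simp: Basis_prod_def Basis_vec_def)
  ultimately show ?thesis by metis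
qed

lemma bij_betw_coord_swap_Basis: "bij_betw (coord_swap L) Basis Basis"
  by (rule bij_betwI[where g = "coord_swap L"]) (auto intro: coord_swap_Basis)

text \<open>Lebesgue measure is determined by its values on boxes. The exchange permutes
  \<open>Basis\<close> and is self-adjoint, so the preimage of a box is the box with exchanged
  corners, whose side lengths are the same up to order.\<close>

lemma distr_coord_swap_lborel:
  "distr (lborel \<Otimes>\<^sub>M lborel) (lborel \<Otimes>\<^sub>M lborel) (coord_swap L)
    = (lborel \<Otimes>\<^sub>M lborel :: ((real^'n::finite) \<times> (real^'n)) measure)"
  unfolding lborel_prod
proof (rule lborel_eqI[symmetric])
  fix l u :: "(real^'n) \<times> (real^'n)"
  assume le: "\<And>b. b \<in> Basis \<Longrightarrow> l \<bullet> b \<le> u \<bullet> b"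
  have "coord_swap L -` box l u = box (coord_swap L l) (coord_swap L u)"
  proof (rule set_eqI)
    fix p
    have "(\<forall>b\<in>Basis. l \<bullet> b < coord_swap L p \<bullet> b \<and> coord_swap L p \<bullet> b < u \<bullet> b)
      \<longleftrightarrow> (\<forall>b\<in>coord_swap L ` Basis. l \<bullet> b < coord_swap L p \<bullet> b \<and> coord_swap L p \<bullet> b < u \<bullet> b)"
      using bij_betw_imp_surj_on[OF bij_betw_coord_swap_Basis[of L]] by simp
    then show "p \<in> coord_swap L -` box l u \<longleftrightarrow> p \<in> box (coord_swap L l) (coord_swap L u)"
      by (simp add: box_def coord_swap_inner)
  qed
  moreover have "\<And>b. b \<in> Basis \<Longrightarrow> coord_swap L l \<bullet> b \<le> coord_swap L u \<bullet> b"
    by (auto simp: coord_swap_inner intro: le coord_swap_Basis)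
  moreover have "coord_swap L \<in> borel_measurable borel"
    using measurable_coord_swap[of L] by (simp add: borel_prod)
  ultimately have "emeasure (distr lborel lborel (coord_swap L)) (box l u)
      = (\<Prod>b\<in>Basis. (coord_swap L u - coord_swap L l) \<bullet> b)"
    by (simp add: emeasure_distr)
  also have "\<dots> = (\<Prod>b\<in>Basis. (u - l) \<bullet> coord_swap L b)"
    by (simp add: coord_swap_inner flip: coord_swap_diff)
  also have "\<dots> = (\<Prod>b\<in>Basis. (u - l) \<bullet> b)"
    by (simp add: prod.reindex_bij_betw[OF bij_betw_coord_swap_Basis, of "\<lambda>b. (u - l) \<bullet> b"])
  finally show "emeasure (distr lborel lborel (coord_swap L)) (box l u)
      = (\<Prod>b\<in>Basis. (u - l) \<bullet> b)" .
qed simp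

section \<open>The standard Gaussian measure and its invariance under exchanges\<close>

lemma gauss_density_pos: "gauss_density x > 0"
  unfolding gauss_density_def by (intro prod_pos) (simp add: normal_density_pos)

lemma continuous_on_gauss_density: "continuous_on UNIV gauss_density"
  unfolding gauss_density_def std_normal_density_def by (intro continuous_intros) auto

lemma borel_measurable_gauss_density [measurable]: "gauss_density \<in> borel_measurable borel"
  by (intro borel_measurable_continuous_onI continuous_on_gauss_density)

lemma sets_gauss [simp, measurable_cong]: "sets gauss = sets borel"
  by (simp add: gauss_def)

lemma space_gauss [simp]: "space gauss = UNIV"
  by (simp add: gauss_def)

lemma prob_space_gauss: "prob_space (gauss :: (real^'n::finite) measure)"
proof
  have "emeasure (gauss :: (real^'n) measure) UNIV
      = (\<integral>\<^sup>+x. (\<Prod>i\<in>UNIV. ennreal (std_normal_density ((x::real^'n) $ i))) \<partial>lborel)"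
    by (simp add: gauss_def emeasure_density gauss_density_def prod_ennreal normal_density_nonneg)
  \<comment> \<open>Reindexing the coordinates by \<open>Basis\<close> gives the form in which the
    integral of a product splits into one-dimensional integrals.\<close>
  also have "\<dots> = (\<integral>\<^sup>+x. (\<Prod>b\<in>Basis. ennreal (std_normal_density ((x::real^'n) \<bullet> b))) \<partial>lborel)"
    by (intro nn_integral_cong prod.reindex_bij_witness[where i = "\<lambda>b. SOME i. b = axis i 1" and j = "\<lambda>i. axis i 1"])
       (auto simp: Basis_vec_def axis_eq_axis inner_axis)
  also have "\<dots> = (\<Prod>b\<in>(Basis::(real^'n) set). \<integral>\<^sup>+x. ennreal (std_normal_density x) \<partial>lborel)"
    by (rule nn_integral_lborel_prod) (auto simp: normal_density_nonneg)
  also have "(\<integral>\<^sup>+x. ennreal (std_normal_density x) \<partial>lborel) = 1"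
    by (subst nn_integral_eq_integral)
       (auto simp: integrable_normal_density integral_normal_density normal_density_nonneg)
  finally show "emeasure (gauss :: (real^'n) measure) (space gauss) = 1" by simp
qed

text \<open>At each coordinate the exchange at most swaps the two one-dimensional factors.\<close>

lemma gauss_density_mix:
  "gauss_density (mix L y x) * gauss_density (mix L x y) = gauss_density x * gauss_density y"
  unfolding gauss_density_def by (auto simp flip: prod.distrib intro!: prod.cong)

lemma gauss_pair_density:
  "gauss \<Otimes>\<^sub>M gauss = density (lborel \<Otimes>\<^sub>M lborel)
     (\<lambda>p::(real^'n::finite) \<times> (real^'n). ennreal (gauss_density (fst p) * gauss_density (snd p)))"
proof -
  interpret prob_space "gauss :: (real^'n) measure" by (rule prob_space_gauss)
  have "sigma_finite_measure (density lborel (\<lambda>x::real^'n. ennreal (gauss_density x)))"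
    using sigma_finite_measure_axioms by (simp add: gauss_def)
  then show ?thesis
    unfolding gauss_def
    by (subst pair_measure_density)
       (auto intro!: density_cong simp: ennreal_mult gauss_density_pos less_imp_le case_prod_beta lborel.sigma_finite_measure_axioms)
qed

lemma distr_coord_swap_gauss:
  "distr (gauss \<Otimes>\<^sub>M gauss) (gauss \<Otimes>\<^sub>M gauss) (coord_swap L)
    = (gauss \<Otimes>\<^sub>M gauss :: ((real^'n::finite) \<times> (real^'n)) measure)"
proof -
  let ?B = "lborel \<Otimes>\<^sub>M lborel :: ((real^'n) \<times> (real^'n)) measure"
  let ?d = "\<lambda>p::(real^'n) \<times> (real^'n). ennreal (gauss_density (fst p) * gauss_density (snd p))"
  have swap [measurable]: "coord_swap L \<in> measurable ?B ?B"
    using measurable_coord_swap[of L] by (simp cong: measurable_cong_sets sets_pair_measure_cong)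
  \<comment> \<open>The density \<open>?d\<close> is unchanged by the exchange, so it may be
    replaced by its pullback and then moved outside \<open>distr\<close>, where the invariance of
    Lebesgue measure applies.\<close>
  have "distr (gauss \<Otimes>\<^sub>M gauss) (gauss \<Otimes>\<^sub>M gauss) (coord_swap L)
      = distr (density ?B (\<lambda>p. ?d (coord_swap L p))) ?B (coord_swap L)"
    unfolding gauss_pair_density
    by (intro distr_cong) (simp_all add: coord_swap_def gauss_density_mix mult.commute)
  also have "\<dots> = density (distr ?B ?B (coord_swap L)) ?d"
    by (rule density_distr[symmetric]) measurable
  also have "\<dots> = gauss \<Otimes>\<^sub>M gauss"
    by (simp add: distr_coord_swap_lborel gauss_pair_density)
  finally show ?thesis .
qed

section \<open>Integration over pairs of independent Gaussian vectors\<close>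

lemma (in pair_sigma_finite) integrable_fst_times_snd:
  fixes f g :: "_ \<Rightarrow> real"
  assumes f: "integrable M1 f" and g: "integrable M2 g"
  shows "integrable (M1 \<Otimes>\<^sub>M M2) (\<lambda>p. f (fst p) * g (snd p))"
proof (rule Fubini_integrable)
  show "(\<lambda>p. f (fst p) * g (snd p)) \<in> borel_measurable (M1 \<Otimes>\<^sub>M M2)"
    using f g by measurable
qed (use f g in \<open>auto simp: abs_mult\<close>)

lemma (in pair_sigma_finite) integral_fst_times_snd:
  fixes f g :: "_ \<Rightarrow> real"
  assumes "integrable M1 f" "integrable M2 g"
  shows "(\<integral>p. f (fst p) * g (snd p) \<partial>(M1 \<Otimes>\<^sub>M M2)) = (\<integral>x. f x \<partial>M1) * (\<integral>y. g y \<partial>M2)"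
  using integral_fst'[OF integrable_fst_times_snd[OF assms]] by simp

interpretation gauss: prob_space "gauss :: (real^'n::finite) measure"
  by (rule prob_space_gauss)

interpretation gauss_pair: pair_prob_space "gauss :: (real^'n::finite) measure" "gauss :: (real^'n) measure" ..

lemma measurable_coord_swap_gauss [measurable]:
  "coord_swap L \<in> measurable (gauss \<Otimes>\<^sub>M gauss) (gauss \<Otimes>\<^sub>M gauss)"
  using measurable_coord_swap[of L] by (simp cong: measurable_cong_sets sets_pair_measure_cong)

lemma integrable_coord_swap:
  fixes F :: "_ \<Rightarrow> real"
  assumes "integrable (gauss \<Otimes>\<^sub>M gauss) F"
  shows "integrable (gauss \<Otimes>\<^sub>M gauss) (\<lambda>p. F (coord_swap L p))"
  by (rule integrable_distr[of _ _ "gauss \<Otimes>\<^sub>M gauss"]) (use assms in \<open>simp_all add: distr_coord_swap_gauss\<close>)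

lemma integral_coord_swap:
  fixes F :: "_ \<Rightarrow> real"
  assumes "integrable (gauss \<Otimes>\<^sub>M gauss) F"
  shows "(\<integral>p. F (coord_swap L p) \<partial>(gauss \<Otimes>\<^sub>M gauss)) = integral\<^sup>L (gauss \<Otimes>\<^sub>M gauss) F"
  using integral_distr[of "coord_swap L" "gauss \<Otimes>\<^sub>M gauss" "gauss \<Otimes>\<^sub>M gauss" F] assms
  by (simp add: distr_coord_swap_gauss)

text \<open>\<open>mix K x y\<close> is the second component of \<open>coord_swap K (x, y)\<close>,
  so it is again standard Gaussian when \<open>x\<close> and \<open>y\<close> are independent. This
  is the disintegration over the \<open>K\<close>-coordinates used for conditional
  probabilities.\<close>

lemma
  fixes g :: "real^'n::finite \<Rightarrow> real"
  assumes "integrable gauss g"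
  shows integral_mix: "(\<integral>x. \<integral>y. g (mix K x y) \<partial>gauss \<partial>gauss) = (\<integral>x. g x \<partial>gauss)"
    and AE_integrable_mix: "AE x in gauss. integrable gauss (\<lambda>y. g (mix K x y))"
proof -
  have *: "integrable (gauss \<Otimes>\<^sub>M gauss) (\<lambda>p::(real^'n) \<times> (real^'n). g (snd p))"
    using gauss_pair.integrable_fst_times_snd[of "\<lambda>_. 1" g] assms by simp
  have **: "integrable (gauss \<Otimes>\<^sub>M gauss) (\<lambda>p. g (mix K (fst p) (snd p)))"
    using integrable_coord_swap[OF *, of K] by (simp add: coord_swap_def)
  show "AE x in gauss. integrable gauss (\<lambda>y. g (mix K x y))"
    using gauss_pair.AE_integrable_fst'[OF **] by simp
  have "(\<integral>x. \<integral>y. g (mix K x y) \<partial>gauss \<partial>gauss) = (\<integral>p. g (snd (coord_swap K p)) \<partial>(gauss \<Otimes>\<^sub>M gauss))"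
    using gauss_pair.integral_fst'[OF **] by (simp add: coord_swap_def)
  also have "\<dots> = (\<integral>x. g x \<partial>gauss)"
    using integral_coord_swap[OF *, of K] gauss_pair.integral_fst_times_snd[of "\<lambda>_. 1" g] assms
    by (simp add: gauss.prob_space[simplified])
  finally show "(\<integral>x. \<integral>y. g (mix K x y) \<partial>gauss \<partial>gauss) = (\<integral>x. g x \<partial>gauss)" .
qed

text \<open>The assumptions say that \<open>A\<close> and \<open>A'\<close> ignore the
  \<open>J\<close>-coordinates while \<open>B\<close> and \<open>B'\<close> depend on nothing else.
  The function \<open>h\<close> will be a slice of the relative density with the
  \<open>K\<close>-coordinates fixed.\<close>

lemma cross_difference:
  fixes h :: "real^'n::finite \<Rightarrow> real"
  assumes h: "integrable gauss h"
    and sets: "A \<in> sets borel" "A' \<in> sets borel" "B \<in> sets borel" "B' \<in> sets borel"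
    and A: "\<And>y z. mix J y z \<in> A \<longleftrightarrow> z \<in> A" "\<And>y z. mix J y z \<in> A' \<longleftrightarrow> z \<in> A'"
    and B: "\<And>y z. mix J y z \<in> B \<longleftrightarrow> y \<in> B" "\<And>y z. mix J y z \<in> B' \<longleftrightarrow> y \<in> B'"
  defines "D \<equiv> \<lambda>p. indicator (A \<inter> B) (fst p) * indicator (A' \<inter> B') (snd p)
        * (h (fst p) * h (snd p) - h (mix J (snd p) (fst p)) * h (mix J (fst p) (snd p)))"
  shows "integrable (gauss \<Otimes>\<^sub>M gauss) D"
    and "(\<integral>p. D p \<partial>(gauss \<Otimes>\<^sub>M gauss)) =
        (\<integral>y. indicator (A \<inter> B) y * h y \<partial>gauss) * (\<integral>y. indicator (A' \<inter> B') y * h y \<partial>gauss)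
      - (\<integral>y. indicator (A \<inter> B') y * h y \<partial>gauss) * (\<integral>y. indicator (A' \<inter> B) y * h y \<partial>gauss)"
proof -
  have ind: "integrable gauss (\<lambda>y. indicator S y * h y)" if "S \<in> sets borel" for S
    using integrable_mult_indicator[OF _ h, of S] that by simp
  define P where "P S T p = (indicator S (fst p) * h (fst p)) * (indicator T (snd p) * h (snd p))"
    for S T and p :: "(real^'n) \<times> (real^'n)"
  have P: "integrable (gauss \<Otimes>\<^sub>M gauss) (P S T)"
      "integral\<^sup>L (gauss \<Otimes>\<^sub>M gauss) (P S T)
        = (\<integral>y. indicator S y * h y \<partial>gauss) * (\<integral>y. indicator T y * h y \<partial>gauss)"
    if "S \<in> sets borel" "T \<in> sets borel" for S T
    unfolding P_def
    by (intro gauss_pair.integrable_fst_times_snd gauss_pair.integral_fst_times_snd ind that)+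
  \<comment> \<open>The exchange carries the conditions \<open>B\<close> and \<open>B'\<close> to
    the other point and leaves \<open>A\<close> and \<open>A'\<close> in place, which is why the
    second term involves \<open>A \<inter> B'\<close> and \<open>A' \<inter> B\<close>.\<close>
  have D: "D = (\<lambda>p. P (A \<inter> B) (A' \<inter> B') p - P (A \<inter> B') (A' \<inter> B) (coord_swap J p))"
    by (auto simp: D_def P_def coord_swap_def A B fun_eq_iff algebra_simps split: split_indicator)
  have i1: "integrable (gauss \<Otimes>\<^sub>M gauss) (P (A \<inter> B) (A' \<inter> B'))"
    and i2: "integrable (gauss \<Otimes>\<^sub>M gauss) (P (A \<inter> B') (A' \<inter> B))"
    using sets by (auto intro: P)
  show "integrable (gauss \<Otimes>\<^sub>M gauss) D"
    unfolding D by (intro Bochner_Integration.integrable_diff i1 integrable_coord_swap i2)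
  show "(\<integral>p. D p \<partial>(gauss \<Otimes>\<^sub>M gauss)) =
        (\<integral>y. indicator (A \<inter> B) y * h y \<partial>gauss) * (\<integral>y. indicator (A' \<inter> B') y * h y \<partial>gauss)
      - (\<integral>y. indicator (A \<inter> B') y * h y \<partial>gauss) * (\<integral>y. indicator (A' \<inter> B) y * h y \<partial>gauss)"
    unfolding D using sets
    by (simp add: Bochner_Integration.integral_diff[OF i1 integrable_coord_swap[OF i2]]
        integral_coord_swap[OF i2] P)
qed

section \<open>Partial derivatives\<close>

lemma has_derivative_partial_deriv:
  assumes "(g has_derivative g') (at x)"
  shows "((\<lambda>t. g (x + t *\<^sub>R axis i 1)) has_real_derivative g' (axis i 1)) (at 0)"
    and "partial_deriv i g x = g' (axis i 1)"
proof -
  have "((\<lambda>t. g (x + t *\<^sub>R axis i 1)) has_derivative (\<lambda>t. g' (t *\<^sub>R axis i 1))) (at 0)"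
    by (rule has_derivative_compose[where g = g]) (auto intro!: derivative_eq_intros assms)
  then show *: "((\<lambda>t. g (x + t *\<^sub>R axis i 1)) has_real_derivative g' (axis i 1)) (at 0)"
    using has_derivative_linear[OF assms]
    by (simp add: has_field_derivative_def linear_cmul mult.commute[of _ "g' (axis i 1)"])
  show "partial_deriv i g x = g' (axis i 1)"
    unfolding partial_deriv_def by (rule DERIV_imp_deriv) (rule *)
qed

text \<open>On the segment from \<open>y\<close> to \<open>x\<close> the direction
  \<open>x - y\<close> has only components in \<open>L\<close>, so the derivative along it is a
  combination of vanishing partial derivatives.\<close>

lemma eq_if_partial_derivs_zero:
  fixes g :: "real^'n::finite \<Rightarrow> real"
  assumes g: "g differentiable_on UNIV"
    and zero: "\<And>i x. i \<in> L \<Longrightarrow> partial_deriv i g x = 0"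
    and agree: "\<And>i. i \<notin> L \<Longrightarrow> x $ i = y $ i"
  shows "g x = g y"
proof -
  have "((\<lambda>t. g (y + t *\<^sub>R (x - y))) has_real_derivative 0) (at t)" for t :: real
  proof -
    obtain g' where g': "(g has_derivative g') (at (y + t *\<^sub>R (x - y)))"
      using g by (auto simp: differentiable_on_def differentiable_def)
    have "x - y = (\<Sum>i\<in>UNIV. (x $ i - y $ i) *\<^sub>R axis i 1)"
      using basis_expansion[of "x - y"] by (simp add: scalar_mult_eq_scaleR)
    then have "g' (x - y) = (\<Sum>i\<in>UNIV. (x $ i - y $ i) *\<^sub>R g' (axis i 1))"
      using has_derivative_linear[OF g'] by (simp add: linear_sum linear_cmul)
    also have "\<dots> = 0"
    proof (rule sum.neutral, rule ballI)
      fix i show "(x $ i - y $ i) *\<^sub>R g' (axis i 1) = 0"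
        using zero[of i] agree[of i] has_derivative_partial_deriv(2)[OF g', of i] by (cases "i \<in> L") auto
    qed
    finally have "g' (x - y) = 0" .
    moreover have "((\<lambda>t. g (y + t *\<^sub>R (x - y))) has_derivative (\<lambda>t. g' (t *\<^sub>R (x - y)))) (at t)"
      by (rule has_derivative_compose[where g = g]) (auto intro!: derivative_eq_intros g')
    ultimately show ?thesis
      using has_derivative_linear[OF g']
      by (simp add: has_field_derivative_def linear_cmul mult_zero_left[abs_def])
  qed
  then have "(\<lambda>t. g (y + t *\<^sub>R (x - y))) 1 = (\<lambda>t. g (y + t *\<^sub>R (x - y))) 0"
    by (intro DERIV_isconst_all) blast
  then show ?thesis by simp
qed

text \<open>Both sides say that an increment of \<open>F\<close> in the \<open>I\<close>-directions
  does not depend on the \<open>J\<close>-coordinates: the left side for finite increments, the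
  right side for infinitesimal ones.\<close>

lemma exchange_iff_mixed_partials_zero:
  fixes F :: "real^'n::finite \<Rightarrow> real"
  assumes F: "F differentiable_on UNIV"
    and F': "\<And>j. partial_deriv j F differentiable_on UNIV"
    and part: "I \<union> J \<union> K = UNIV" "I \<inter> J = {}" "I \<inter> K = {}" "J \<inter> K = {}"
  shows "(\<forall>u v. (\<forall>k\<in>K. u $ k = v $ k) \<longrightarrow> F u + F v = F (mix J v u) + F (mix J u v))
    \<longleftrightarrow> (\<forall>i\<in>I. \<forall>j\<in>J. \<forall>x. partial_deriv i (partial_deriv j F) x = 0)"
    (is "?exchange \<longleftrightarrow> ?zero")
proof
  assume ex: ?exchange
  show ?zero
  proof (intro ballI allI)
    fix i j x assume ij: "i \<in> I" "j \<in> J"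
    have const: "partial_deriv j F (x + t *\<^sub>R axis i 1) = partial_deriv j F x" for t
    proof -
      \<comment> \<open>The exchange identity for \<open>x + t e_i + s e_j\<close> and
        \<open>x\<close>: moving by \<open>t\<close> along \<open>i\<close> changes \<open>F\<close>
        by an amount independent of \<open>s\<close>, hence leaves the derivative in
        \<open>s\<close> unchanged.\<close>
      have "F (x + t *\<^sub>R axis i 1 + s *\<^sub>R axis j 1) = F (x + s *\<^sub>R axis j 1) + (F (x + t *\<^sub>R axis i 1) - F x)" for s
      proof -
        have "mix J x (x + t *\<^sub>R axis i 1 + s *\<^sub>R axis j 1) = x + t *\<^sub>R axis i 1"
          "mix J (x + t *\<^sub>R axis i 1 + s *\<^sub>R axis j 1) x = x + s *\<^sub>R axis j 1"
          using ij part by (auto simp: vec_eq_iff axis_def)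
        moreover have "\<forall>k\<in>K. (x + t *\<^sub>R axis i 1 + s *\<^sub>R axis j 1) $ k = x $ k"
          using ij part by (auto simp: axis_def)
        ultimately show ?thesis
          using ex[rule_format, of "x + t *\<^sub>R axis i 1 + s *\<^sub>R axis j 1" x] by simp
      qed
      moreover obtain g' where "(F has_derivative g') (at x)"
        using F by (auto simp: differentiable_on_def differentiable_def)
      note d = has_derivative_partial_deriv[OF this, of j]
      ultimately show ?thesis
        unfolding partial_deriv_def[of j F "x + t *\<^sub>R axis i 1"] d(2)
        by (intro DERIV_imp_deriv) (auto intro!: derivative_eq_intros d(1))
    qed
    show "partial_deriv i (partial_deriv j F) x = 0"
      unfolding partial_deriv_def[of i] const by simp
  qed
next
  assume zero: ?zero
  show ?exchange
  proof (intro allI impI)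
    fix u v :: "real^'n" assume uv: "\<forall>k\<in>K. u $ k = v $ k"
    \<comment> \<open>The \<open>I\<close>-part of \<open>u - v\<close>: \<open>mix J u v\<close>
      has the \<open>J\<close>-coordinates of \<open>u\<close>, and \<open>u\<close> and
      \<open>v\<close> agree on \<open>K\<close>.\<close>
    define w where "w = u - mix J u v"
    have w: "w $ i = 0" if "i \<notin> I" for i
      using that uv part unfolding w_def by auto
    have shift: "(\<lambda>y. y + w) differentiable_on UNIV"
      by (intro derivative_intros)
    have Fw: "(\<lambda>y. F (y + w)) differentiable_on UNIV"
      using differentiable_on_compose[OF shift, of F] F by (meson differentiable_on_subset subset_UNIV)
    \<comment> \<open>The exchange identity asserts that this increment takes the same value at
      \<open>v\<close> and at \<open>mix J u v\<close>, two points that differ only in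
      \<open>J\<close>-coordinates.\<close>
    define H where "H y = F (y + w) - F y" for y
    have "partial_deriv j H y = 0" if j: "j \<in> J" for j y
    proof -
      obtain g1 g2 where g: "(F has_derivative g1) (at (y + w))" "(F has_derivative g2) (at y)"
        using F unfolding differentiable_on_def differentiable_def by (metis UNIV_I)
      have "((\<lambda>y. y + w) has_derivative (\<lambda>h. h)) (at y)"
        using has_derivative_add[OF has_derivative_ident has_derivative_const[of w]] by simp
      from has_derivative_compose[OF this g(1)] have "((\<lambda>y. F (y + w)) has_derivative g1) (at y)"
        by simp
      then have "(H has_derivative (\<lambda>h. g1 h - g2 h)) (at y)"
        unfolding H_def by (intro derivative_intros g)
      then have "partial_deriv j H y = partial_deriv j F (y + w) - partial_deriv j F y"
        using has_derivative_partial_deriv(2) g by metis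
      \<comment> \<open>The vector \<open>w\<close> moves only \<open>I\<close>-coordinates, along
        which the partial derivatives of \<open>partial_deriv j F\<close> vanish.\<close>
      also have "partial_deriv j F (y + w) = partial_deriv j F y"
        by (rule eq_if_partial_derivs_zero[where L = I]) (use zero j w F' in auto)
      finally show ?thesis by simp
    qed
    moreover have "H differentiable_on UNIV"
      unfolding H_def by (intro derivative_intros F Fw)
    ultimately have "H v = H (mix J u v)"
      using eq_if_partial_derivs_zero[of H J v "mix J u v"] by simp
    moreover have "v + w = mix J v u"
      using part uv unfolding w_def by (auto simp: vec_eq_iff)
    moreover have "mix J u v + w = u"
      by (simp add: w_def)
    ultimately show "F u + F v = F (mix J v u) + F (mix J u v)"
      by (simp add: H_def)
  qed
qed

text \<open>The first partial derivatives of \<open>ln f\<close> are the quotients of those of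
  \<open>f\<close> by \<open>f\<close>, and here numerator and denominator are
  differentiable.\<close>

lemma C_k_Suc_ln_differentiable:
  fixes f :: "real^'n::finite \<Rightarrow> real"
  assumes f: "C_k (Suc (Suc k)) f" and pos: "\<And>x. f x > 0"
  shows "(\<lambda>x. ln (f x)) differentiable_on UNIV"
    and "partial_deriv j (\<lambda>x. ln (f x)) differentiable_on UNIV"
proof -
  have d: "f differentiable_on UNIV" "partial_deriv j f differentiable_on UNIV"
    using f by auto
  have *: "((\<lambda>x. ln (f x)) has_derivative (\<lambda>h. g' h / f x)) (at x)" if "(f has_derivative g') (at x)" for g' x
    using that pos[of x] by (auto intro!: derivative_eq_intros simp: divide_inverse)
  show "(\<lambda>x. ln (f x)) differentiable_on UNIV"
    using d(1) * unfolding differentiable_on_def differentiable_def by blast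
  have "partial_deriv j (\<lambda>x. ln (f x)) = (\<lambda>x. partial_deriv j f x / f x)"
  proof
    fix x
    obtain g' where g': "(f has_derivative g') (at x)"
      using d(1) by (auto simp: differentiable_on_def differentiable_def)
    show "partial_deriv j (\<lambda>x. ln (f x)) x = partial_deriv j f x / f x"
      using has_derivative_partial_deriv(2)[OF *[OF g']] has_derivative_partial_deriv(2)[OF g'] by simp
  qed
  moreover have "(\<lambda>x. partial_deriv j f x / f x) differentiable_on UNIV"
    using d pos unfolding differentiable_on_def
    by (metis UNIV_I differentiable_divide less_irrefl)
  ultimately show "partial_deriv j (\<lambda>x. ln (f x)) differentiable_on UNIV" by simp
qed

section \<open>Conditional probabilities given a subvector\<close>

text \<open>Fixing the \<open>K\<close>-coordinates commutes with exchanging the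
  \<open>J\<close>-coordinates, so an exchange of arguments of a slice is an exchange of points of
  the full space.\<close>

lemma mix_nested:
  assumes "J \<inter> K = {}"
  shows "mix K x (mix J z y) = mix J (mix K x z) (mix K x y)"
  using assms by (auto simp: vec_eq_iff)

lemma subvector_mix:
  "L \<subseteq> K \<Longrightarrow> subvector L (mix K x y) = subvector L x"
  "L \<inter> K = {} \<Longrightarrow> subvector L (mix K x y) = subvector L y"
  by (auto simp: subvector_def fun_eq_iff restrict_def)

lemma measurable_subvector [measurable]:
  "subvector L \<in> measurable borel (Pi\<^sub>M L (\<lambda>_. borel))"
  unfolding subvector_def by (intro measurable_restrict borel_measurable_continuous_onI continuous_intros)

lemma sets_subvector_vimage:
  "A \<in> sets (Pi\<^sub>M L (\<lambda>_. borel)) \<Longrightarrow> subvector L -` A \<in> sets borel"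
  using measurable_sets[OF measurable_subvector] by auto

lemma AE_gauss_iff: "(AE x in gauss. P x) \<longleftrightarrow> (AE x in lborel. P x)"
  unfolding gauss_def by (subst AE_density) (auto simp: gauss_density_pos)

lemma AE_gauss_pair_iff:
  "(AE p in gauss \<Otimes>\<^sub>M gauss. P p)
    \<longleftrightarrow> (AE p in (lborel :: ((real^'n::finite) \<times> (real^'n)) measure). P p)"
  unfolding gauss_pair_density lborel_prod[symmetric]
  by (subst AE_density, measurable) (simp add: gauss_density_pos)

text \<open>A nonempty open set is not a null set, so it cannot lie within the exceptional
  set.\<close>

lemma AE_lborel_obtain_open:
  assumes "AE x in (lborel :: 'a::euclidean_space measure). P x" "open S" "S \<noteq> {}"
  obtains x where "x \<in> S" "P x"
proof (rule ccontr)
  assume "\<not> thesis"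
  with that have "S \<subseteq> {x. \<not> P x}" by auto
  moreover obtain N where N: "{x. \<not> P x} \<subseteq> N" "N \<in> null_sets lborel"
    using assms(1) by (auto simp: eventually_ae_filter)
  ultimately have "S \<in> null_sets lborel"
    using \<open>open S\<close> null_sets_subset[OF N(2), of S] by auto
  then have "S \<in> null_sets lebesgue"
    by (rule null_sets_completionI)
  then show False
    using open_not_negligible assms by (auto simp: negligible_iff_null_sets)
qed

section \<open>Random vectors with a positive continuous density\<close>

locale positive_density = prob_space M for M :: "'a measure" +
  fixes X :: "'a \<Rightarrow> real^'p::finite" and f :: "real^'p \<Rightarrow> real"
  assumes distributed_X: "distributed M lborel X (\<lambda>x. ennreal (f x))"
    and pos: "\<And>x. f x > 0"
    and cont: "continuous_on UNIV f"
begin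

definition rel_density :: "real^'p \<Rightarrow> real" where
  "rel_density x = f x / gauss_density x"

text \<open>The unnormalised conditional probability of \<open>E\<close> given that \<open>X\<close>
  has the \<open>K\<close>-coordinates of \<open>x\<close>. The Bochner integral gives it the value
  0 where the integrand is not integrable.\<close>

definition cond_mass :: "'p set \<Rightarrow> (real^'p) set \<Rightarrow> real^'p \<Rightarrow> real" where
  "cond_mass K E x = (\<integral>y. indicator E (mix K x y) * rel_density (mix K x y) \<partial>gauss)"

lemma rel_density_pos: "rel_density x > 0"
  by (simp add: rel_density_def pos gauss_density_pos)

lemma continuous_on_rel_density: "continuous_on UNIV rel_density"
  unfolding rel_density_def[abs_def]
  by (intro continuous_intros cont continuous_on_gauss_density) (metis gauss_density_pos less_irrefl)

lemma borel_measurable_rel_density [measurable]: "rel_density \<in> borel_measurable borel"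
  by (intro borel_measurable_continuous_onI continuous_on_rel_density)

lemma borel_measurable_f [measurable]: "f \<in> borel_measurable borel"
  by (intro borel_measurable_continuous_onI cont)

lemma measurable_X [measurable]: "X \<in> borel_measurable M"
  using distributed_measurable[OF distributed_X] by simp

lemma integral_gauss:
  fixes h :: "real^'p \<Rightarrow> real"
  assumes [measurable]: "h \<in> borel_measurable borel"
  shows "(\<integral>x. h x * rel_density x \<partial>gauss) = (\<integral>x. h x * f x \<partial>lborel)"
  unfolding gauss_def
  by (subst integral_real_density)
     (auto simp: rel_density_def gauss_density_pos less_imp_le less_imp_neq[OF gauss_density_pos, symmetric]
        intro!: Bochner_Integration.integral_cong)

lemma integral_X:
  fixes h :: "real^'p \<Rightarrow> real"
  assumes [measurable]: "h \<in> borel_measurable borel"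
  shows "(\<integral>\<omega>. h (X \<omega>) \<partial>M) = (\<integral>x. h x * rel_density x \<partial>gauss)"
  using distributed_integral[OF distributed_X, of h] pos
  by (simp add: integral_gauss less_imp_le mult.commute)

lemma integrable_rel_density: "integrable gauss rel_density"
proof -
  have "integrable lborel f"
    using distributed_integrable[OF distributed_X, of "\<lambda>_. 1"] pos by (auto simp: less_imp_le)
  moreover have "gauss_density x *\<^sub>R rel_density x = f x" for x
    using gauss_density_pos[of x] by (simp add: rel_density_def)
  ultimately show ?thesis
    unfolding gauss_def
    by (subst integrable_density) (auto simp: gauss_density_pos less_imp_le)
qed

text \<open>By positivity of both densities, the law of \<open>X\<close>, Lebesgue measure and
  \<open>gauss\<close> have the same null sets.\<close>

lemma AE_X:
  assumes "Measurable.pred borel P"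
  shows "(AE \<omega> in M. P (X \<omega>)) \<longleftrightarrow> (AE x in gauss. P x)"
  using distributed_AE2[OF distributed_X, of P] assms pos by (simp add: AE_gauss_iff)

lemma AE_integrable_rel_density_mix: "AE x in gauss. integrable gauss (\<lambda>y. rel_density (mix K x y))"
  by (rule AE_integrable_mix[OF integrable_rel_density])

lemma borel_measurable_cond_mass [measurable]:
  assumes [measurable]: "E \<in> sets borel"
  shows "cond_mass K E \<in> borel_measurable borel"
  unfolding cond_mass_def[abs_def] by measurable

lemma cond_mass_mix: "cond_mass K E (mix K x y) = cond_mass K E x"
  by (simp add: cond_mass_def)

lemma integrable_indicator_rel_density_mix:
  assumes "integrable gauss (\<lambda>y. rel_density (mix K x y))" and [measurable]: "E \<in> sets borel"
  shows "integrable gauss (\<lambda>y. indicator E (mix K x y) * rel_density (mix K x y))"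
  by (rule Bochner_Integration.integrable_bound[OF assms(1)])
     (auto split: split_indicator)

lemma cond_mass_nonneg: "0 \<le> cond_mass K E x"
  unfolding cond_mass_def by (intro Bochner_Integration.integral_nonneg) (simp add: rel_density_pos less_imp_le)

lemma cond_mass_le:
  assumes "integrable gauss (\<lambda>y. rel_density (mix K x y))" and "E \<in> sets borel"
  shows "cond_mass K E x \<le> cond_mass K UNIV x"
  unfolding cond_mass_def
  by (intro integral_mono integrable_indicator_rel_density_mix assms)
     (auto simp: rel_density_pos less_imp_le split: split_indicator)

lemma cond_mass_UNIV_pos:
  assumes "integrable gauss (\<lambda>y. rel_density (mix K x y))"
  shows "cond_mass K UNIV x > 0"
proof -
  have "cond_mass K UNIV x \<noteq> 0"
  proof
    assume "cond_mass K UNIV x = 0"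
    then have "AE y in gauss. rel_density (mix K x y) = 0"
      using integral_nonneg_eq_0_iff_AE[OF assms]
      by (simp add: cond_mass_def rel_density_pos less_imp_le)
    moreover have "rel_density (mix K x y) \<noteq> 0" for y using rel_density_pos[of "mix K x y"] by simp
    ultimately show False by (simp add: gauss.AE_False)
  qed
  with cond_mass_nonneg[of K UNIV x] show ?thesis by simp
qed

text \<open>Dividing by zero makes the ratio \<open>0\<close> where the conditional density is not integrable.\<close>

lemma cond_mass_ratio_bounds:
  assumes "E \<in> sets borel"
  shows "0 \<le> cond_mass K E x / cond_mass K UNIV x" "cond_mass K E x / cond_mass K UNIV x \<le> 1"
proof -
  show "0 \<le> cond_mass K E x / cond_mass K UNIV x"
    by (simp add: cond_mass_nonneg)
  show "cond_mass K E x / cond_mass K UNIV x \<le> 1"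
  proof (cases "integrable gauss (\<lambda>y. rel_density (mix K x y))")
    case True
    then show ?thesis
      using cond_mass_le[OF True assms] cond_mass_UNIV_pos[OF True] by simp
  next
    case False
    then show ?thesis by (simp add: cond_mass_def not_integrable_integral_eq)
  qed
qed

text \<open>The ratio is checked against the characterisation of conditional expectation: it is a
  measurable function of the subvector, and it has the right integral over every event determined by
  the subvector.\<close>

lemma cond_prob_given_subvector:
  assumes E [measurable]: "E \<in> sets borel"
  shows "AE \<omega> in M. cond_prob_given M (Pi\<^sub>M K (\<lambda>_. borel)) (\<lambda>\<omega>. subvector K (X \<omega>)) (X -` E \<inter> space M) \<omega>
    = cond_mass K E (X \<omega>) / cond_mass K UNIV (X \<omega>)"
proof -
  let ?N = "Pi\<^sub>M K (\<lambda>_. borel) :: ('p \<Rightarrow> real) measure"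
  let ?W = "\<lambda>\<omega>. subvector K (X \<omega>)"
  let ?F = "vimage_algebra (space M) ?W ?N"
  let ?r = "\<lambda>x. cond_mass K E x / cond_mass K UNIV x"
  have W [measurable]: "?W \<in> measurable M ?N"
    by measurable
  have WN: "?W \<in> space M \<rightarrow> space ?N"
    using measurable_space[OF W] by auto
  interpret F: finite_measure_subalgebra M ?F
    by unfold_locales (simp add: subalgebra_def sets_image_in_sets[OF refl W])
  have r_bounded: "\<bar>?r x\<bar> \<le> 1" for x
    using cond_mass_ratio_bounds[OF E, of K x] by simp
  show ?thesis
    unfolding cond_prob_given_def
  proof (rule F.real_cond_exp_charact)
    show "integrable M (indicat_real (X -` E \<inter> space M))"
      by (intro integrable_real_indicator) (auto simp: less_top[symmetric])
    show "integrable M (\<lambda>\<omega>. ?r (X \<omega>))"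
      by (rule integrable_const_bound[where B = 1]) (use r_bounded in auto)
    \<comment> \<open>Extension by zero recovers from a \<open>K\<close>-subvector a point with the
      same \<open>K\<close>-coordinates. As the ratio depends on these alone, it factors measurably
      through \<open>?W\<close>.\<close>
    define emb :: "('p \<Rightarrow> real) \<Rightarrow> real^'p" where "emb w = (\<chi> i. if i \<in> K then w i else 0)" for w
    have emb: "emb \<in> borel_measurable ?N"
    proof (subst borel_measurable_euclidean_space, intro ballI)
      fix b :: "real^'p" assume "b \<in> Basis"
      then obtain i where b: "b = axis i 1"
        by (auto simp: Basis_vec_def)
      show "(\<lambda>w. emb w \<bullet> b) \<in> borel_measurable ?N"
        by (cases "i \<in> K") (simp_all add: b emb_def inner_axis)
    qed
    have "?r x = ?r (emb (subvector K x))" for x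
    proof -
      have "emb (subvector K x) = mix K x 0"
        by (simp add: emb_def subvector_def vec_eq_iff)
      then show ?thesis by (simp add: cond_mass_mix)
    qed
    moreover have "(\<lambda>\<omega>. ?r (emb (?W \<omega>))) \<in> borel_measurable ?F"
      by (rule measurable_compose[OF measurable_vimage_algebra1[OF WN]], rule measurable_compose[OF emb]) measurable
    ultimately show "(\<lambda>\<omega>. ?r (X \<omega>)) \<in> borel_measurable ?F"
      by simp
  next
    fix A assume "A \<in> sets ?F"
    then obtain S where S: "S \<in> sets ?N" and A: "A = ?W -` S \<inter> space M"
      by (auto simp: sets_vimage_algebra2[OF WN])
    \<comment> \<open>The conditioning event as a set of points of the full space. Its indicator
      depends only on \<open>K\<close>-coordinates and so comes out of the inner integral.\<close>
    define T where "T = subvector K -` S"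
    have T [measurable]: "T \<in> sets borel"
      unfolding T_def by (rule sets_subvector_vimage[OF S])
    have T_mix: "indicator T (mix K x y) = (indicator T x :: real)" for x y
      by (simp add: T_def subvector_mix indicator_def)
    have cond_mass_UNIV: "(\<integral>y. rel_density (mix K x y) \<partial>gauss) = cond_mass K UNIV x" for x
      by (simp add: cond_mass_def)
    have lhs_int: "integrable gauss (\<lambda>x. indicator T x * indicator E x * rel_density x)"
      by (rule Bochner_Integration.integrable_bound[OF integrable_rel_density]) (auto split: split_indicator)
    have rhs_int: "integrable gauss (\<lambda>x. indicator T x * ?r x * rel_density x)"
    proof (rule Bochner_Integration.integrable_bound[OF integrable_rel_density])
      show "AE x in gauss. norm (indicator T x * ?r x * rel_density x) \<le> norm (rel_density x)"
        using mult_right_mono[OF r_bounded, of "\<bar>rel_density _\<bar>"]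
        by (intro AE_I2) (auto simp: abs_mult split: split_indicator)
    qed measurable
    have "(\<integral>\<omega>\<in>A. indicat_real (X -` E \<inter> space M) \<omega> \<partial>M)
        = (\<integral>\<omega>. indicator T (X \<omega>) * indicator E (X \<omega>) \<partial>M)"
      unfolding set_lebesgue_integral_def
      by (intro Bochner_Integration.integral_cong) (auto simp: A T_def split: split_indicator)
    also have "\<dots> = (\<integral>x. indicator T x * indicator E x * rel_density x \<partial>gauss)"
      by (rule integral_X) measurable
    also have "\<dots> = (\<integral>x. indicator T x * cond_mass K E x \<partial>gauss)"
      unfolding integral_mix[OF lhs_int, of K, symmetric]
      by (simp add: T_mix cond_mass_def mult.assoc)
    \<comment> \<open>For almost every \<open>x\<close> the slice is integrable, the denominator of
      \<open>?r\<close> is positive, and it cancels.\<close>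
    also have "\<dots> = (\<integral>x. indicator T x * ?r x * cond_mass K UNIV x \<partial>gauss)"
    proof (rule integral_cong_AE)
      show "AE x in gauss. indicator T x * cond_mass K E x = indicator T x * ?r x * cond_mass K UNIV x"
        using AE_integrable_rel_density_mix[of K] by eventually_elim (use cond_mass_UNIV_pos in force)
    qed measurable
    \<comment> \<open>The disintegration read backwards: \<open>indicator T\<close> and
      \<open>?r\<close> are constant along the inner integral, which therefore only produces
      \<open>cond_mass K UNIV x\<close>.\<close>
    also have "\<dots> = (\<integral>x. indicator T x * ?r x * rel_density x \<partial>gauss)"
      unfolding integral_mix[OF rhs_int, of K, symmetric]
      using cond_mass_UNIV by (simp add: T_mix cond_mass_mix)
    also have "\<dots> = (\<integral>\<omega>. indicator T (X \<omega>) * ?r (X \<omega>) \<partial>M)"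
      by (rule integral_X[symmetric]) measurable
    also have "\<dots> = (\<integral>\<omega>\<in>A. ?r (X \<omega>) \<partial>M)"
      unfolding set_lebesgue_integral_def
      by (intro Bochner_Integration.integral_cong) (auto simp: A T_def split: split_indicator)
    finally show "(\<integral>\<omega>\<in>A. indicat_real (X -` E \<inter> space M) \<omega> \<partial>M) = (\<integral>\<omega>\<in>A. ?r (X \<omega>) \<partial>M)" .
  qed
qed

end

section \<open>The exchange identity\<close>

definition cyl :: "'n set \<Rightarrow> real^'n::finite \<Rightarrow> real \<Rightarrow> (real^'n) set" where
  "cyl L u d = {x. \<forall>i\<in>L. \<bar>x $ i - u $ i\<bar> < d}"

lemma open_cyl: "open (cyl L u d)"
proof -
  have "cyl L u d = (\<Inter>i\<in>L. {x. \<bar>x $ i - u $ i\<bar> < d})"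
    by (auto simp: cyl_def)
  also have "open \<dots>"
    by (intro open_INT finite ballI open_Collect_less continuous_intros)
  finally show ?thesis .
qed

lemma center_in_cyl: "d > 0 \<Longrightarrow> u \<in> cyl L u d"
  by (simp add: cyl_def)

text \<open>Makes cylinders available as test events in the definition of conditional
  independence.\<close>

lemma cyl_eq_subvector_vimage:
  obtains A where "A \<in> sets (Pi\<^sub>M L (\<lambda>_. borel))" "cyl L u d = subvector L -` A"
proof
  show "(\<Pi>\<^sub>E i\<in>L. {u $ i - d<..<u $ i + d}) \<in> sets (Pi\<^sub>M L (\<lambda>_. borel))"
    by (intro sets_PiM_I_finite) auto
  show "cyl L u d = subvector L -` (\<Pi>\<^sub>E i\<in>L. {u $ i - d<..<u $ i + d})"
    by (rule set_eqI) (simp add: cyl_def subvector_def Pi_iff restrict_PiE_iff abs_diff_less_iff)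
qed

lemma open_contains_cyl_pair:
  fixes u v :: "real^'n::finite"
  assumes "open S" "(u, v) \<in> S"
  obtains d where "d > 0" "\<And>y z. y \<in> cyl UNIV u d \<Longrightarrow> z \<in> cyl UNIV v d \<Longrightarrow> (y, z) \<in> S"
proof -
  obtain U V where UV: "open U" "open V" "(u, v) \<in> U \<times> V" "U \<times> V \<subseteq> S"
    by (rule open_prod_elim[OF assms])
  have *: "\<exists>d>0. cyl UNIV w d \<subseteq> W" if "open W" "w \<in> W" for w :: "real^'n" and W
  proof -
    obtain e where e: "e > 0" "ball w e \<subseteq> W"
      by (rule openE[OF \<open>open W\<close> \<open>w \<in> W\<close>])
    \<comment> \<open>The Euclidean norm is at most the sum of the \<open>CARD('n)\<close> absolute
      coordinates, each less than \<open>e / CARD('n)\<close>.\<close>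
    have "cyl UNIV w (e / CARD('n)) \<subseteq> ball w e"
    proof
      fix x assume x: "x \<in> cyl UNIV w (e / CARD('n))"
      have "norm (x - w) \<le> (\<Sum>i\<in>UNIV. \<bar>(x - w) $ i\<bar>)"
        by (rule norm_le_l1_cart)
      also have "\<dots> < (\<Sum>i\<in>(UNIV::'n set). e / CARD('n))"
        using x by (intro sum_strict_mono) (auto simp: cyl_def)
      finally show "x \<in> ball w e"
        by (simp add: dist_norm norm_minus_commute)
    qed
    with e have "e / CARD('n) > 0" "cyl UNIV w (e / CARD('n)) \<subseteq> W"
      by simp_all
    then show ?thesis by blast
  qed
  obtain d1 where d1: "d1 > 0" "cyl UNIV u d1 \<subseteq> U"
    using *[of U u] UV by auto
  obtain d2 where d2: "d2 > 0" "cyl UNIV v d2 \<subseteq> V"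
    using *[of V v] UV by auto
  show thesis
  proof (rule that[of "min d1 d2"])
    fix y z assume "y \<in> cyl UNIV u (min d1 d2)" "z \<in> cyl UNIV v (min d1 d2)"
    then have "y \<in> cyl UNIV u d1" "z \<in> cyl UNIV v d2"
      by (auto simp: cyl_def)
    with d1 d2 UV show "(y, z) \<in> S" by auto
  qed (simp add: d1 d2)
qed

section \<open>Conditional independence as an exchange identity for the density\<close>

context positive_density
begin

text \<open>Conditional probabilities become ratios of masses almost surely, and the common
  denominator is almost everywhere positive and can be cleared.\<close>

lemma cond_indep_subvectors_iff:
  "cond_indep_subvectors M X I J K \<longleftrightarrow>
    (\<forall>A\<in>sets (Pi\<^sub>M I (\<lambda>_. borel)). \<forall>B\<in>sets (Pi\<^sub>M J (\<lambda>_. borel)). AE x in gauss.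
      cond_mass K (subvector I -` A \<inter> subvector J -` B) x * cond_mass K UNIV x
        = cond_mass K (subvector I -` A) x * cond_mass K (subvector J -` B) x)"
proof -
  let ?P = "\<lambda>E. cond_prob_given M (Pi\<^sub>M K (\<lambda>_. borel)) (\<lambda>\<omega>. subvector K (X \<omega>)) E"
  let ?r = "\<lambda>E x. cond_mass K E x / cond_mass K UNIV x"
  have key: "(AE \<omega> in M. ?P ((\<lambda>\<omega>. subvector I (X \<omega>)) -` A \<inter> space M \<inter> ((\<lambda>\<omega>. subvector J (X \<omega>)) -` B \<inter> space M)) \<omega>
          = ?P ((\<lambda>\<omega>. subvector I (X \<omega>)) -` A \<inter> space M) \<omega> * ?P ((\<lambda>\<omega>. subvector J (X \<omega>)) -` B \<inter> space M) \<omega>)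
    \<longleftrightarrow> (AE x in gauss.
      cond_mass K (subvector I -` A \<inter> subvector J -` B) x * cond_mass K UNIV x
        = cond_mass K (subvector I -` A) x * cond_mass K (subvector J -` B) x)" (is "?L \<longleftrightarrow> ?R")
    if A: "A \<in> sets (Pi\<^sub>M I (\<lambda>_. borel))" and B: "B \<in> sets (Pi\<^sub>M J (\<lambda>_. borel))" for A B
  proof -
    let ?A = "subvector I -` A" and ?B = "subvector J -` B"
    have [measurable]: "?A \<in> sets borel" "?B \<in> sets borel"
      using A B by (auto intro: sets_subvector_vimage)
    have vimages: "(\<lambda>\<omega>. subvector I (X \<omega>)) -` A \<inter> space M = X -` ?A \<inter> space M"
      "(\<lambda>\<omega>. subvector J (X \<omega>)) -` B \<inter> space M = X -` ?B \<inter> space M"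
      "X -` ?A \<inter> space M \<inter> (X -` ?B \<inter> space M) = X -` (?A \<inter> ?B) \<inter> space M"
      by auto
    have "?L \<longleftrightarrow> (AE \<omega> in M. ?r (?A \<inter> ?B) (X \<omega>) = ?r ?A (X \<omega>) * ?r ?B (X \<omega>))"
      unfolding vimages
    proof (rule eventually_subst)
      have "?A \<inter> ?B \<in> sets borel" "?A \<in> sets borel" "?B \<in> sets borel"
        by measurable
      note cond_probs = this[THEN cond_prob_given_subvector[of _ K]]
      show "AE \<omega> in M. (?P (X -` (?A \<inter> ?B) \<inter> space M) \<omega>
            = ?P (X -` ?A \<inter> space M) \<omega> * ?P (X -` ?B \<inter> space M) \<omega>)
          = (?r (?A \<inter> ?B) (X \<omega>) = ?r ?A (X \<omega>) * ?r ?B (X \<omega>))"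
        using cond_probs by eventually_elim simp
    qed
    also have "\<dots> \<longleftrightarrow> (AE x in gauss. ?r (?A \<inter> ?B) x = ?r ?A x * ?r ?B x)"
      by (rule AE_X) measurable
    also have "\<dots> \<longleftrightarrow> ?R"
    proof (rule eventually_subst)
      show "AE x in gauss. (?r (?A \<inter> ?B) x = ?r ?A x * ?r ?B x) =
        (cond_mass K (?A \<inter> ?B) x * cond_mass K UNIV x = cond_mass K ?A x * cond_mass K ?B x)"
        using AE_integrable_rel_density_mix[of K]
      proof eventually_elim
        fix x assume "integrable gauss (\<lambda>y. rel_density (mix K x y))"
        from cond_mass_UNIV_pos[OF this]
        show "(?r (?A \<inter> ?B) x = ?r ?A x * ?r ?B x) =
          (cond_mass K (?A \<inter> ?B) x * cond_mass K UNIV x = cond_mass K ?A x * cond_mass K ?B x)"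
          by (simp add: field_simps)
      qed
    qed
    finally show ?thesis .
  qed
  have meas: "(\<lambda>\<omega>. subvector L (X \<omega>)) \<in> measurable M (Pi\<^sub>M L (\<lambda>_. borel))" for L
    by measurable
  show ?thesis
    unfolding cond_indep_subvectors_def cond_indep_var_def
    by (simp only: meas simp_thms) (intro ball_cong refl key)
qed

lemma cond_indep_if_exchange:
  assumes part: "I \<union> J \<union> K = UNIV" "I \<inter> J = {}" "I \<inter> K = {}" "J \<inter> K = {}"
    and exchange: "\<And>u v. (\<And>k. k \<in> K \<Longrightarrow> u $ k = v $ k) \<Longrightarrow> 
      rel_density u * rel_density v = rel_density (mix J v u) * rel_density (mix J u v)"
  shows "cond_indep_subvectors M X I J K"
  unfolding cond_indep_subvectors_iff
proof (intro ballI)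
  fix A B :: "('p \<Rightarrow> real) set"
  assume A: "A \<in> sets (Pi\<^sub>M I (\<lambda>_. borel))" and B: "B \<in> sets (Pi\<^sub>M J (\<lambda>_. borel))"
  let ?A = "subvector I -` A" and ?B = "subvector J -` B"
  show "AE x in gauss. cond_mass K (?A \<inter> ?B) x * cond_mass K UNIV x = cond_mass K ?A x * cond_mass K ?B x"
    using AE_integrable_rel_density_mix[of K]
  proof eventually_elim
    fix x assume h: "integrable gauss (\<lambda>y. rel_density (mix K x y))"
    have sets: "?A \<in> sets borel" "?B \<in> sets borel"
      using A B by (auto intro: sets_subvector_vimage)
    have inv: "mix J y z \<in> ?A \<longleftrightarrow> z \<in> ?A" "mix J y z \<in> ?B \<longleftrightarrow> y \<in> ?B" for y z
      using part by (simp_all add: subvector_mix)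
    have mass: "cond_mass K E x = (\<integral>y. indicator E y * rel_density (mix K x y) \<partial>gauss)"
      if "\<And>y. mix K x y \<in> E \<longleftrightarrow> y \<in> E" for E
      using that by (simp add: cond_mass_def indicator_def)
    have memK: "mix K x y \<in> ?A \<longleftrightarrow> y \<in> ?A" "mix K x y \<in> ?B \<longleftrightarrow> y \<in> ?B" for y
      using part by (simp_all add: subvector_mix)
    have "rel_density (mix K x y) * rel_density (mix K x z)
        - rel_density (mix K x (mix J z y)) * rel_density (mix K x (mix J y z)) = 0" for y z
      unfolding mix_nested[OF part(4)]
      using exchange[of "mix K x y" "mix K x z"] by simp
    \<comment> \<open>The case \<open>A' = B' = UNIV\<close> of \<open>cross_difference\<close>,
      whose integrand vanishes identically; the intersections with \<open>UNIV\<close> are kept to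
      match its form.\<close>
    then have "(\<integral>y. indicator (?A \<inter> ?B) y * rel_density (mix K x y) \<partial>gauss)
          * (\<integral>y. indicator (UNIV \<inter> UNIV) y * rel_density (mix K x y) \<partial>gauss)
        - (\<integral>y. indicator (?A \<inter> UNIV) y * rel_density (mix K x y) \<partial>gauss)
          * (\<integral>y. indicator (UNIV \<inter> ?B) y * rel_density (mix K x y) \<partial>gauss) = 0"
      by (subst cross_difference(2)[OF h sets(1) _ sets(2) _ inv(1) _ inv(2), symmetric]) simp_all
    then show "cond_mass K (?A \<inter> ?B) x * cond_mass K UNIV x = cond_mass K ?A x * cond_mass K ?B x"
      by (subst (1 2 3 4) mass) (simp_all add: memK del: vimage_eq)
  qed
qed

text \<open>A strict excess would persist, by continuity, on small boxes around \<open>u\<close> and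
  \<open>v\<close> and make a cross difference positive, whereas conditional independence makes it
  zero. One inequality is enough, as it can also be applied to the exchanged pair.\<close>

lemma exchange_le_if_cond_indep:
  assumes part: "I \<union> J \<union> K = UNIV" "I \<inter> J = {}" "I \<inter> K = {}" "J \<inter> K = {}"
    and indep: "cond_indep_subvectors M X I J K"
    and uv: "\<And>k. k \<in> K \<Longrightarrow> u $ k = v $ k"
  shows "rel_density u * rel_density v \<le> rel_density (mix J v u) * rel_density (mix J u v)"
proof (rule ccontr)
  assume excess: "\<not> ?thesis"
  define G where "G p = rel_density (fst p) * rel_density (snd p)
    - rel_density (mix J (snd p) (fst p)) * rel_density (mix J (fst p) (snd p))" for p
  have "continuous_on UNIV G"
    unfolding G_def
    by (intro continuous_intros continuous_on_compose2[OF continuous_on_rel_density]) auto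
  then have "open {p. 0 < G p}"
    by (intro open_Collect_less continuous_intros)
  moreover have "(u, v) \<in> {p. 0 < G p}"
    using excess by (simp add: G_def)
  ultimately obtain d where d: "d > 0"
    and G: "\<And>y z. y \<in> cyl UNIV u d \<Longrightarrow> z \<in> cyl UNIV v d \<Longrightarrow> G (y, z) > 0"
    by (rule open_contains_cyl_pair) auto
  let ?A = "cyl I u d" and ?A' = "cyl I v d" and ?B = "cyl J u d" and ?B' = "cyl J v d"
  have sets: "cyl L w d \<in> sets borel" for L :: "'p set" and w
    by (simp add: open_cyl)
  have AE_cond_mass: "AE x in gauss. cond_mass K (cyl I a d \<inter> cyl J b d) x * cond_mass K UNIV x
      = cond_mass K (cyl I a d) x * cond_mass K (cyl J b d) x" for a b
  proof -
    obtain A where A: "A \<in> sets (Pi\<^sub>M I (\<lambda>_. borel))" "cyl I a d = subvector I -` A"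
      by (rule cyl_eq_subvector_vimage)
    obtain B where B: "B \<in> sets (Pi\<^sub>M J (\<lambda>_. borel))" "cyl J b d = subvector J -` B"
      by (rule cyl_eq_subvector_vimage)
    show ?thesis
      unfolding A(2) B(2)
      using indep[unfolded cond_indep_subvectors_iff, rule_format, OF A(1) B(1)] .
  qed
  \<comment> \<open>The factorisations hold only almost everywhere and may fail at \<open>u\<close>.
    The four needed ones and the integrability of the slice are therefore collected, and a good
    \<open>x\<close> is taken from the open cylinder around the \<open>K\<close>-coordinates of
    \<open>u\<close>.\<close>
  have "AE x in lborel. integrable gauss (\<lambda>y. rel_density (mix K x y)) \<and>
      (\<forall>a\<in>{u, v}. \<forall>b\<in>{u, v}. cond_mass K (cyl I a d \<inter> cyl J b d) x * cond_mass K UNIV x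
        = cond_mass K (cyl I a d) x * cond_mass K (cyl J b d) x)"
    using AE_cond_mass[of u u] AE_cond_mass[of u v] AE_cond_mass[of v u] AE_cond_mass[of v v]
      AE_integrable_rel_density_mix[of K]
    unfolding AE_gauss_iff[symmetric] by eventually_elim simp
  then obtain x where x: "x \<in> cyl K u d" and "integrable gauss (\<lambda>y. rel_density (mix K x y)) \<and>
      (\<forall>a\<in>{u, v}. \<forall>b\<in>{u, v}. cond_mass K (cyl I a d \<inter> cyl J b d) x * cond_mass K UNIV x
        = cond_mass K (cyl I a d) x * cond_mass K (cyl J b d) x)"
    by (rule AE_lborel_obtain_open[OF _ open_cyl[of K u d]]) (use center_in_cyl[OF d, of u K] in auto)
  then have h: "integrable gauss (\<lambda>y. rel_density (mix K x y))"
    and factor: "\<And>a b. a \<in> {u, v} \<Longrightarrow> b \<in> {u, v} \<Longrightarrow>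
      cond_mass K (cyl I a d \<inter> cyl J b d) x * cond_mass K UNIV x
        = cond_mass K (cyl I a d) x * cond_mass K (cyl J b d) x"
    by blast+
  have mixK: "mix K x (mix J z y) = mix J (mix K x z) (mix K x y)" for y z
    by (rule mix_nested[OF part(4)])
  define D where "D p = indicator (?A \<inter> ?B) (fst p) * indicator (?A' \<inter> ?B') (snd p)
    * G (mix K x (fst p), mix K x (snd p))" for p
  have inv: "mix J y z \<in> cyl I w d \<longleftrightarrow> z \<in> cyl I w d" "mix J y z \<in> cyl J w d \<longleftrightarrow> y \<in> cyl J w d" for y z w
    using part by (auto simp: cyl_def)
  have ind: "indicator (cyl I a d \<inter> cyl J b d) (mix K x y) = (indicator (cyl I a d \<inter> cyl J b d) y :: real)" for a b y
    using part by (force simp: cyl_def indicator_def)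
  note cross = cross_difference[OF h sets sets sets sets inv(1) inv(1) inv(2) inv(2),
    of u u v v, unfolded mixK]
  have D_eq: "D p = indicator (?A \<inter> ?B) (fst p) * indicator (?A' \<inter> ?B') (snd p)
      * (rel_density (mix K x (fst p)) * rel_density (mix K x (snd p))
          - rel_density (mix J (mix K x (snd p)) (mix K x (fst p)))
            * rel_density (mix J (mix K x (fst p)) (mix K x (snd p))))" for p
    by (simp add: D_def G_def)
  have intD: "integrable (gauss \<Otimes>\<^sub>M gauss) D"
    using cross(1) by (simp add: D_eq[abs_def])
  \<comment> \<open>The \<open>K\<close>-coordinates of \<open>x\<close> are close to those of
    \<open>u\<close>, which are also those of \<open>v\<close>, so the two mixed points lie in the
    cubes around \<open>u\<close> and \<open>v\<close>.\<close>
  have G_pos: "G (mix K x y, mix K x z) > 0" if "y \<in> ?A \<inter> ?B" "z \<in> ?A' \<inter> ?B'" for y z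
    using that x uv part by (intro G) (auto simp: cyl_def)
  have "integral\<^sup>L (gauss \<Otimes>\<^sub>M gauss) D
      = cond_mass K (?A \<inter> ?B) x * cond_mass K (?A' \<inter> ?B') x
      - cond_mass K (?A \<inter> ?B') x * cond_mass K (?A' \<inter> ?B) x"
    using cross(2) by (simp add: D_eq[abs_def] cond_mass_def ind)
  also have "\<dots> = 0"
  proof -
    let ?m = "\<lambda>E. cond_mass K E x"
    note factors = factor[of u u, simplified] factor[of u v, simplified]
      factor[of v u, simplified] factor[of v v, simplified]
    \<comment> \<open>By the factorisations both sides are the product of the masses of
      \<open>?A\<close>, \<open>?A'\<close>, \<open>?B\<close> and \<open>?B'\<close>; the square of
      \<open>?m UNIV\<close> then cancels.\<close>
    have "(?m (?A \<inter> ?B) * ?m UNIV) * (?m (?A' \<inter> ?B') * ?m UNIV)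
        = (?m (?A \<inter> ?B') * ?m UNIV) * (?m (?A' \<inter> ?B) * ?m UNIV)"
      unfolding factors by (simp only: mult_ac)
    moreover have "?m UNIV \<noteq> 0"
      using cond_mass_UNIV_pos[OF h] by simp
    ultimately show ?thesis by simp
  qed
  finally have "integral\<^sup>L (gauss \<Otimes>\<^sub>M gauss) D = 0" .
  moreover have "D p \<ge> 0" for p
    using G_pos[of "fst p" "snd p"] by (auto simp: D_def split: split_indicator)
  \<comment> \<open>Being nonnegative with integral zero, \<open>D\<close> vanishes almost
    everywhere, hence somewhere in the nonempty open product of boxes on which it is
    positive.\<close>
  ultimately have "AE p in gauss \<Otimes>\<^sub>M gauss. D p = 0"
    using integral_nonneg_eq_0_iff_AE[OF intD] by simp
  then have "AE p in lborel. D p = 0"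
    unfolding AE_gauss_pair_iff .
  then obtain p where "p \<in> (?A \<inter> ?B) \<times> (?A' \<inter> ?B')" "D p = 0"
  proof (rule AE_lborel_obtain_open)
    show "open ((?A \<inter> ?B) \<times> (?A' \<inter> ?B'))"
      by (intro open_Times open_Int open_cyl)
    have "(u, v) \<in> (?A \<inter> ?B) \<times> (?A' \<inter> ?B')"
      by (simp add: center_in_cyl d)
    then show "(?A \<inter> ?B) \<times> (?A' \<inter> ?B') \<noteq> {}"
      by blast
  qed
  then show False
    using G_pos[of "fst p" "snd p"] by (auto simp: D_def)
qed

lemma cond_indep_iff_exchange:
  assumes part: "I \<union> J \<union> K = UNIV" "I \<inter> J = {}" "I \<inter> K = {}" "J \<inter> K = {}"
  shows "cond_indep_subvectors M X I J K \<longleftrightarrow>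
    (\<forall>u v. (\<forall>k\<in>K. u $ k = v $ k) \<longrightarrow> f u * f v = f (mix J v u) * f (mix J u v))"
proof -
  have rel_density_iff: "rel_density u * rel_density v = rel_density (mix J v u) * rel_density (mix J u v)
      \<longleftrightarrow> f u * f v = f (mix J v u) * f (mix J u v)" for u v
  proof -
    \<comment> \<open>Both products carry the same Gaussian denominator, which cancels.\<close>
    have "rel_density u * rel_density v = (f u * f v) / (gauss_density u * gauss_density v)"
      "rel_density (mix J v u) * rel_density (mix J u v)
        = (f (mix J v u) * f (mix J u v)) / (gauss_density u * gauss_density v)"
      by (simp_all only: rel_density_def times_divide_times_eq gauss_density_mix)
    moreover have "gauss_density u * gauss_density v \<noteq> 0"
      using gauss_density_pos[of u] gauss_density_pos[of v] by simp
    ultimately show ?thesis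
      by (simp only: divide_cancel_right simp_thms)
  qed
  show ?thesis
  proof
    assume ci: "cond_indep_subvectors M X I J K"
    show "\<forall>u v. (\<forall>k\<in>K. u $ k = v $ k) \<longrightarrow> f u * f v = f (mix J v u) * f (mix J u v)"
    proof (intro allI impI)
      fix u v :: "real^'p" assume uv: "\<forall>k\<in>K. u $ k = v $ k"
      have le: "rel_density u * rel_density v \<le> rel_density (mix J v u) * rel_density (mix J u v)"
        by (rule exchange_le_if_cond_indep[OF part ci]) (use uv in blast)
      have agree: "mix J v u $ k = mix J u v $ k" if "k \<in> K" for k
        using uv that by simp
      \<comment> \<open>The same inequality for the exchanged pair, which again agrees on
        \<open>K\<close>; a second exchange restores \<open>u\<close> and \<open>v\<close>.\<close>
      have ge: "rel_density (mix J v u) * rel_density (mix J u v) \<le> rel_density u * rel_density v"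
        using exchange_le_if_cond_indep[OF part ci agree] by simp
      from le ge have "rel_density u * rel_density v = rel_density (mix J v u) * rel_density (mix J u v)"
        by (rule order_antisym)
      then show "f u * f v = f (mix J v u) * f (mix J u v)"
        by (simp only: rel_density_iff)
    qed
  next
    assume "\<forall>u v. (\<forall>k\<in>K. u $ k = v $ k) \<longrightarrow> f u * f v = f (mix J v u) * f (mix J u v)"
    then show "cond_indep_subvectors M X I J K"
      by (intro cond_indep_if_exchange[OF part]) (metis rel_density_iff)
  qed
qed

end

section \<open>Passage to the logarithm and to differential cumulants\<close>

theorem proposition3:
  fixes M :: "'a measure"
    and X :: "'a \<Rightarrow> real^'p::finite"
    and f :: "real^'p \<Rightarrow> real"
    and I J K :: "'p set"
  assumes "prob_space M"
    and "distributed M lborel X (\<lambda>x. ennreal (f x))"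
    and "\<And>x. f x > 0"
    and "C_k (CARD('p) + 1) f"
    and "I \<union> J \<union> K = UNIV"
    and "I \<inter> J = {}" and "I \<inter> K = {}" and "J \<inter> K = {}"
  shows "cond_indep_subvectors M X I J K \<longleftrightarrow>
    (\<forall>i\<in>I. \<forall>j\<in>J. \<forall>x. diff_cumulant f i j x = 0)"
proof -
  \<comment> \<open>The index type is nonempty, so \<open>CARD('p) + 1\<close> is at least 2 and
    \<open>f\<close> has the two orders of differentiability that the mixed partial derivatives of
    \<open>ln f\<close> call for.\<close>
  obtain k where "CARD('p) = Suc k"
    using not0_implies_Suc by fastforce
  then have C: "C_k (Suc (Suc k)) f"
    using assms(4) by simp
  interpret positive_density M X f
    using assms(1-3) C
    by (intro positive_density.intro positive_density_axioms.intro)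
       (auto intro: differentiable_imp_continuous_on)
  \<comment> \<open>The logarithm is injective on positive reals and turns the multiplicative
    exchange identity for \<open>f\<close> into the additive one for \<open>ln f\<close>.\<close>
  have ln_iff: "f u * f v = f (mix J v u) * f (mix J u v) \<longleftrightarrow>
      ln (f u) + ln (f v) = ln (f (mix J v u)) + ln (f (mix J u v))" for u v
  proof -
    have "f u * f v > 0" "f (mix J v u) * f (mix J u v) > 0"
      by (simp_all add: pos)
    then show ?thesis
      using ln_inj_iff[of "f u * f v" "f (mix J v u) * f (mix J u v)"]
      by (simp add: ln_mult pos pos[THEN less_imp_neq, symmetric])
  qed
  show ?thesis
    unfolding cond_indep_iff_exchange[OF assms(5-8)] ln_iff diff_cumulant_def
    by (rule exchange_iff_mixed_partials_zero[OF C_k_Suc_ln_differentiable[OF C pos] assms(5-8)])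
qed

end
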